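(* Let $M$ be a finite matroid which is 3-flat. Then $M$ is pseudomodular.
   Context: Let $M$ be a matroid on ground set $N$ with rank function $r$, and let $\mathcal{F}$ be its set of flats (sets $F$ with $r(F\cup\{n\})>r(F)$ for all $n\notin F$). For a finite collection (multiset) of flats $\mathcal{C} = \{F_i : i \in I\}$, put $F_S = \bigcap_{i\in S} F_i$ for $\emptyset \neq S \subseteq I$ and $F_\emptyset = \bigcup_{i\in I} F_i$, and define $\Delta(\mathcal{C}) = \sum_{S \subseteq I} (-1)^{|S|} r(F_S)$. $M$ is called $n$-flat if $\Delta(\mathcal{C}) \leq 0$ for every such collection $\mathcal{C}$ of flats with $|\mathcal{C}| \leq n$. For flats $A,B$, write $r(A/B) := r(A\cup B)-r(B)$; a flat $B_0$ is the pseudointersection of $A$ and $B$ if for every flat $B_1\subseteq B$, $r(A/B_1)=r(A/B)$ holds if and only if $B_0\subseteq B_1$. $M$ is pseudomodular if for all flats $A,B$ the pseudointersection of $A$ and $B$ exists. *)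

theory Defs
  imports Main
begin

locale matroid =
  fixes N :: "'a set" and indep :: "'a set \<Rightarrow> bool"
  assumes finite_ground: "finite N"
    and indep_subset_ground: "indep X \<Longrightarrow> X \<subseteq> N"
    and indep_empty: "indep {}"
    and indep_subset: "indep X \<Longrightarrow> Y \<subseteq> X \<Longrightarrow> indep Y"
    and augment: "indep X \<Longrightarrow> indep Y \<Longrightarrow> card Y < card X \<Longrightarrow> \<exists>x \<in> X - Y. indep (insert x Y)"
begin

definition rank :: "'a set \<Rightarrow> nat" where
  "rank X = Max (card ` {I. indep I \<and> I \<subseteq> X})"

definition flat :: "'a set \<Rightarrow> bool" where
  "flat F \<longleftrightarrow> F \<subseteq> N \<and> (\<forall>x \<in> N - F. rank F < rank (insert x F))"

text \<open>A multiset of flats is given by an indexed family \<open>F\<close> on an index set \<open>I\<close>, in which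
  repetitions are allowed. By convention \<open>S = {}\<close> gives the union of the whole family,
  not for the empty intersection.\<close>

definition family_inter :: "'i set \<Rightarrow> ('i \<Rightarrow> 'a set) \<Rightarrow> 'i set \<Rightarrow> 'a set" where
  "family_inter I F S = (if S = {} then (\<Union>i\<in>I. F i) else (\<Inter>i\<in>S. F i))"

definition Delta :: "'i set \<Rightarrow> ('i \<Rightarrow> 'a set) \<Rightarrow> int" where
  "Delta I F = (\<Sum>S \<in> Pow I. (-1) ^ card S * int (rank (family_inter I F S)))"

text \<open>Index sets in \<open>nat\<close> suffice, since every finite set is in bijection with one of them.\<close>

definition n_flat :: "nat \<Rightarrow> bool" where
  "n_flat n \<longleftrightarrow>
     (\<forall>(I :: nat set) F. finite I \<and> card I \<le> n \<and> (\<forall>i\<in>I. flat (F i)) \<longrightarrow> Delta I F \<le> 0)"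

definition rel_rank :: "'a set \<Rightarrow> 'a set \<Rightarrow> int" where
  "rel_rank A B = int (rank (A \<union> B)) - int (rank B)"

definition pseudointersection :: "'a set \<Rightarrow> 'a set \<Rightarrow> 'a set \<Rightarrow> bool" where
  "pseudointersection A B B0 \<longleftrightarrow>
     flat B0 \<and> (\<forall>B1. flat B1 \<and> B1 \<subseteq> B \<longrightarrow> (rel_rank A B1 = rel_rank A B \<longleftrightarrow> B0 \<subseteq> B1))"

definition pseudomodular :: bool where
  "pseudomodular \<longleftrightarrow> (\<forall>A B. flat A \<and> flat B \<longrightarrow> (\<exists>B0. pseudointersection A B B0))"

end

end

theory Submission
  imports Defs
begin

text \<open>For a flat \<open>B\<close>, call a flat \<open>B\<^sub>1 \<subseteq> B\<close> good if \<open>r(A/B\<^sub>1) = r(A/B)\<close>. Since \<open>r(A/_)\<close> is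
  antitone by submodularity, good flats are upward closed below \<open>B\<close>, so it is enough that
  they are closed under intersection. If \<open>B\<^sub>1\<close> and \<open>B\<^sub>2\<close> are good, apply 3-flatness to \<open>B\<close>,
  \<open>cl(A \<union> B\<^sub>1)\<close> and \<open>cl(A \<union> B\<^sub>2)\<close>. Goodness of \<open>B\<^sub>i\<close> forces \<open>B \<inter> cl(A \<union> B\<^sub>i) = B\<^sub>i\<close>, and the
  inequality \<open>\<Delta> \<le> 0\<close> becomes
  \<open>r(cl(A \<union> B\<^sub>1) \<inter> cl(A \<union> B\<^sub>2)) - r(B\<^sub>1 \<inter> B\<^sub>2) \<le> r(A/B)\<close>, which bounds
  \<open>r(A/(B\<^sub>1 \<inter> B\<^sub>2))\<close> from above.\<close>

context matroid
begin

lemma finite_indep: "indep X \<Longrightarrow> finite X"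
  using finite_ground indep_subset_ground finite_subset by blast

lemma finite_indep_subsets: "finite {I. indep I \<and> I \<subseteq> X}"
  by (rule finite_subset[of _ "Pow N"]) (use indep_subset_ground finite_ground in auto)

lemma card_le_rank: "indep I \<Longrightarrow> I \<subseteq> X \<Longrightarrow> card I \<le> rank X"
  unfolding rank_def by (rule Max_ge) (use finite_indep_subsets in auto)

lemma basis_exists: "\<exists>I. indep I \<and> I \<subseteq> X \<and> card I = rank X"
proof -
  have "rank X \<in> card ` {I. indep I \<and> I \<subseteq> X}"
    unfolding rank_def by (rule Max_in) (use finite_indep_subsets indep_empty in auto)
  then show ?thesis by auto
qed

lemma rank_mono: "X \<subseteq> Y \<Longrightarrow> rank X \<le> rank Y"
  using basis_exists[of X] card_le_rank by (metis subset_trans)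

text \<open>Repeated augmentation from a maximum independent subset of \<open>X\<close> closes the
  gap between \<open>card I\<close> and \<open>rank X\<close>, which is the induction
  measure.\<close>

lemma indep_extends_to_basis:
  assumes "indep I" "I \<subseteq> X"
  shows "\<exists>J. indep J \<and> I \<subseteq> J \<and> J \<subseteq> X \<and> card J = rank X"
  using assms
proof (induction "rank X - card I" arbitrary: I rule: less_induct)
  case less
  show ?case
  proof (cases "card I = rank X")
    case True
    then show ?thesis using less.prems by blast
  next
    case False
    then have lt: "card I < rank X" using card_le_rank[OF less.prems] by linarith
    obtain B where B: "indep B" "B \<subseteq> X" "card B = rank X" using basis_exists by blast
    then obtain x where x: "x \<in> B - I" "indep (insert x I)"
      using augment[of B I] less.prems lt by auto
    have "card (insert x I) = Suc (card I)"
      using x finite_indep[OF less.prems(1)] by simp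
    then have "\<exists>J. indep J \<and> insert x I \<subseteq> J \<and> J \<subseteq> X \<and> card J = rank X"
      using less.hyps[of "insert x I"] lt x B less.prems by auto
    then show ?thesis by blast
  qed
qed

text \<open>Extend a basis \<open>I\<close> of the intersection to a basis \<open>K\<close> of the
  union and count: \<open>K \<inter> X\<close> and \<open>K \<inter> Y\<close> are independent,
  cover \<open>K\<close>, and both contain \<open>I\<close>.\<close>

lemma rank_submodular: "rank (X \<union> Y) + rank (X \<inter> Y) \<le> rank X + rank Y"
proof -
  obtain I where I: "indep I" "I \<subseteq> X \<inter> Y" "card I = rank (X \<inter> Y)"
    using basis_exists by blast
  then obtain K where K: "indep K" "I \<subseteq> K" "K \<subseteq> X \<union> Y" "card K = rank (X \<union> Y)"
    using indep_extends_to_basis[of I "X \<union> Y"] by blast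
  note fin = finite_indep[OF K(1)]
  have "card (K \<inter> X) \<le> rank X" "card (K \<inter> Y) \<le> rank Y"
    using K indep_subset card_le_rank by (meson inf_le1 inf_le2)+
  moreover have "card (K \<inter> X) + card (K \<inter> Y) = card K + card (K \<inter> X \<inter> (K \<inter> Y))"
    using card_Un_Int[of "K \<inter> X" "K \<inter> Y"] fin K(3)
    by (metis Int_Un_distrib finite_Int inf.absorb1)
  moreover have "card I \<le> card (K \<inter> X \<inter> (K \<inter> Y))"
    using I K fin by (intro card_mono) auto
  ultimately show ?thesis using I K by linarith
qed

lemma rank_Un_cong:
  assumes "X \<subseteq> F" "rank F = rank X"
  shows "rank (F \<union> Y) = rank (X \<union> Y)"
proof -
  have "rank (F \<union> Y) + rank X \<le> rank (F \<union> (X \<union> Y)) + rank (F \<inter> (X \<union> Y))"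
    using assms by (intro add_mono rank_mono) auto
  also have "\<dots> \<le> rank F + rank (X \<union> Y)" by (rule rank_submodular)
  finally have "rank (F \<union> Y) \<le> rank (X \<union> Y)" using assms by simp
  moreover have "rank (X \<union> Y) \<le> rank (F \<union> Y)" using assms by (intro rank_mono) auto
  ultimately show ?thesis by simp
qed

text \<open>Submodularity for \<open>A \<union> S\<close> and \<open>T\<close>, whose intersection
  contains \<open>S\<close>.\<close>

lemma rel_rank_antimono:
  assumes "S \<subseteq> T"
  shows "rel_rank A T \<le> rel_rank A S"
proof -
  have "rank (A \<union> T) + rank S \<le> rank ((A \<union> S) \<union> T) + rank ((A \<union> S) \<inter> T)"
    using assms by (intro add_mono rank_mono) auto
  also have "\<dots> \<le> rank (A \<union> S) + rank T" by (rule rank_submodular)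
  finally show ?thesis unfolding rel_rank_def by linarith
qed

text \<open>A point outside the intersection misses one of the two flats, here \<open>H\<close>; the
  rank it adds can only grow when \<open>H\<close> shrinks to the intersection.\<close>

lemma flat_Int:
  assumes "flat F" "flat G"
  shows "flat (F \<inter> G)"
proof -
  have gt: "rank (F \<inter> G) < rank (insert x (F \<inter> G))"
    if "flat H" "F \<inter> G \<subseteq> H" "x \<in> N - H" for H x
  proof -
    have "rank H < rank (insert x H)" using that unfolding flat_def by blast
    then show ?thesis
      using rel_rank_antimono[OF that(2), of "{x}"] unfolding rel_rank_def by simp
  qed
  show ?thesis
    unfolding flat_def using assms gt[of F] gt[of G] by (auto simp: flat_def)
qed

lemma flat_eq_of_rank_le:
  assumes "flat F" "F \<subseteq> X" "X \<subseteq> N" "rank X \<le> rank F"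
  shows "X = F"
proof (rule ccontr)
  assume "X \<noteq> F"
  then obtain x where "x \<in> X - F" using assms by blast
  then have "rank F < rank (insert x F)" "rank (insert x F) \<le> rank X"
    using assms unfolding flat_def by (blast, intro rank_mono) auto
  then show False using assms by simp
qed

text \<open>The closure arises as a largest superset of \<open>X\<close> in \<open>N\<close> of the
  same rank: a further point keeping the rank would give a larger one.\<close>

lemma flat_hull_exists:
  assumes "X \<subseteq> N"
  shows "\<exists>F. flat F \<and> X \<subseteq> F \<and> rank F = rank X"
proof -
  let ?P = "\<lambda>F. X \<subseteq> F \<and> F \<subseteq> N \<and> rank F = rank X"
  have "\<exists>F. ?P F \<and> (\<forall>G. ?P G \<longrightarrow> card G \<le> card F)"
    using assms card_mono[OF finite_ground]
    by (intro ex_has_greatest_nat[of ?P X card "Suc (card N)"]) (auto simp: less_Suc_eq_le)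
  then obtain F where F: "?P F" and maxF: "\<And>G. ?P G \<Longrightarrow> card G \<le> card F" by blast
  have "rank F < rank (insert x F)" if "x \<in> N - F" for x
  proof (rule ccontr)
    assume "\<not> rank F < rank (insert x F)"
    then have "rank (insert x F) = rank X"
      using F rank_mono[of F "insert x F"] by (simp add: subset_insertI)
    then have "card (insert x F) \<le> card F" using maxF[of "insert x F"] F that by auto
    moreover have "finite F" using F finite_ground finite_subset by blast
    ultimately show False using that by simp
  qed
  then show ?thesis using F unfolding flat_def by blast
qed

lemma Delta_three:
  "Delta {0, 1, 2 :: nat} F =
     int (rank (F 0 \<union> F 1 \<union> F 2)) - int (rank (F 0)) - int (rank (F 1)) - int (rank (F 2))
     + int (rank (F 0 \<inter> F 1)) + int (rank (F 0 \<inter> F 2)) + int (rank (F 1 \<inter> F 2))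
     - int (rank (F 0 \<inter> F 1 \<inter> F 2))"
  by (simp add: Delta_def Pow_insert sum.insert_if insert_eq_iff doubleton_eq_iff
      family_inter_def Un_assoc Int_assoc)

lemma three_flat_ineq:
  assumes "n_flat 3" "flat X" "flat Y" "flat Z"
  shows "rank (X \<union> Y \<union> Z) + rank (X \<inter> Y) + rank (X \<inter> Z) + rank (Y \<inter> Z)
     \<le> rank X + rank Y + rank Z + rank (X \<inter> Y \<inter> Z)"
proof -
  \<comment> \<open>The three indices are distinct even when some of the flats coincide.\<close>
  define F where "F i = (if i = 0 then X else if i = 1 then Y else Z)" for i :: nat
  have "Delta {0, 1, 2 :: nat} F \<le> 0"
    using assms unfolding n_flat_def
    by (elim allE[of _ "{0, 1, 2}"] allE[of _ F]) (auto simp: F_def)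
  then show ?thesis unfolding Delta_three by (simp add: F_def)
qed

text \<open>Enlarging \<open>B1\<close> to \<open>B \<inter> C\<close> keeps the union with
  \<open>A\<close> inside \<open>C\<close>, so its rank does not grow, while the relative rank of
  \<open>A\<close> does not drop. Hence \<open>B \<inter> C\<close> has no more rank than the flat
  \<open>B1\<close> it contains.\<close>

lemma flat_hull_Int_eq:
  assumes "flat B" "flat B1" "B1 \<subseteq> B" "rel_rank A B1 = rel_rank A B"
    and "flat C" "A \<union> B1 \<subseteq> C" "rank C = rank (A \<union> B1)"
  shows "B \<inter> C = B1"
proof (rule flat_eq_of_rank_le)
  show "B \<inter> C \<subseteq> N" using assms unfolding flat_def by blast
  have "rel_rank A B1 \<le> rel_rank A (B \<inter> C)"
    using rel_rank_antimono[of "B \<inter> C" B A] assms by simp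
  moreover have "rank (A \<union> (B \<inter> C)) \<le> rank C" using assms by (intro rank_mono) auto
  ultimately show "rank (B \<inter> C) \<le> rank B1" using assms unfolding rel_rank_def by simp
qed (use assms in auto)

lemma rel_rank_Int:
  assumes "n_flat 3" "flat A" "flat B"
    and B1: "flat B1" "B1 \<subseteq> B" "rel_rank A B1 = rel_rank A B"
    and B2: "flat B2" "B2 \<subseteq> B" "rel_rank A B2 = rel_rank A B"
  shows "rel_rank A (B1 \<inter> B2) = rel_rank A B"
proof (rule antisym)
  have sub: "A \<union> B1 \<subseteq> N" "A \<union> B2 \<subseteq> N" using assms unfolding flat_def by auto
  obtain C1 where C1: "flat C1" "A \<union> B1 \<subseteq> C1" "rank C1 = rank (A \<union> B1)"
    using flat_hull_exists[OF sub(1)] by blast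
  obtain C2 where C2: "flat C2" "A \<union> B2 \<subseteq> C2" "rank C2 = rank (A \<union> B2)"
    using flat_hull_exists[OF sub(2)] by blast
  have e1: "B \<inter> C1 = B1" and e2: "B \<inter> C2 = B2"
    using flat_hull_Int_eq[OF assms(3) B1 C1] flat_hull_Int_eq[OF assms(3) B2 C2] by auto
  \<comment> \<open>Rewriting with \<open>e1\<close> turns the triple intersection in the 3-flat
    inequality into \<open>B1 \<inter> C2\<close>.\<close>
  have e3: "B1 \<inter> C2 = B1 \<inter> B2" using e2 B1(2) by blast
  have "rank (A \<union> B) \<le> rank (B \<union> C1 \<union> C2)" "rank (A \<union> (B1 \<inter> B2)) \<le> rank (C1 \<inter> C2)"
    using C1 C2 by (auto intro!: rank_mono)
  \<comment> \<open>With d = r(A/B), each \<open>Ci\<close> contributes r(\<open>Ci\<close>) -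
    r(\<open>Bi\<close>) = d, and the union term gives back r(A \<union> B) - r(B) = d, so a single
    d remains as the bound.\<close>
  then show "rel_rank A (B1 \<inter> B2) \<le> rel_rank A B"
    using three_flat_ineq[OF assms(1,3) C1(1) C2(1)] C1(3) C2(3) B1(3) B2(3)
    unfolding e1 e2 e3 rel_rank_def by linarith
  show "rel_rank A B \<le> rel_rank A (B1 \<inter> B2)"
    using B1 by (intro rel_rank_antimono) auto
qed

lemma pseudointersection_exists:
  assumes "n_flat 3" "flat A" "flat B"
  shows "\<exists>B0. pseudointersection A B B0"
proof -
  let ?good = "\<lambda>C. flat C \<and> C \<subseteq> B \<and> rel_rank A C = rel_rank A B"
  have "?good B" using assms by simp
  \<comment> \<open>Closure under intersection makes a good flat of least cardinality the least one
    under inclusion.\<close>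
  then obtain B0 where B0: "?good B0" and minB0: "\<And>C. ?good C \<Longrightarrow> card B0 \<le> card C"
    using ex_has_least_nat[of ?good B card] by blast
  have fin: "finite B0" using B0 finite_ground finite_subset unfolding flat_def by blast
  have least: "B0 \<subseteq> C" if "?good C" for C
  proof -
    have "?good (B0 \<inter> C)"
      using B0 that flat_Int rel_rank_Int[OF assms, of B0 C] by blast
    then have "B0 \<inter> C = B0" using minB0 fin by (intro card_seteq) auto
    then show ?thesis by blast
  qed
  have "rel_rank A C = rel_rank A B" if "C \<subseteq> B" "B0 \<subseteq> C" for C
    using rel_rank_antimono[OF that(1), of A] rel_rank_antimono[OF that(2), of A] B0 by simp
  then show ?thesis
    unfolding pseudointersection_def using B0 least by blast
qed

end

theorem theorem2:
  fixes N :: "'a set" and indep :: "'a set \<Rightarrow> bool"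
  assumes "matroid N indep"
    and "matroid.n_flat N indep 3"
  shows "matroid.pseudomodular N indep"
proof -
  interpret matroid N indep by (rule assms(1))
  show ?thesis
    unfolding pseudomodular_def using pseudointersection_exists assms(2) by blast
qed

end
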